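(* Let $h$ be a dimension function and $N\in\mathbb{N}$. Let $D\subseteq\mathbb{R}^N$ be a closed set containing arbitrarily large balls, and let $\mathcal{F}$ be a family of continuous functions $f:D\to\mathbb{R}^N$. Suppose there exist an integer $L\ge2$ and a countable family $\Psi=\{\psi_j\}_{j\in\mathbb{N}}$ of continuous, injective and closed functions $\psi_j:\Omega_j\to\mathbb{R}^N$ defined on closed sets $\Omega_j\subseteq\mathbb{R}^N$, such that each inverse $\psi_j^{-1}:\mathrm{Im}(\psi_j)\to\Omega_j$ is locally bilipschitz, and such that for each $f\in\mathcal{F}$ there exists $\psi_j\in\Psi$ for which $\psi_j\circ f$ is well defined (i.e. $f(D)\subseteq\Omega_j$) and is bilipschitz with constants $(\frac1L,1)$ on $D$. Then there exists an $\mathcal{F}_\sigma$ set $E\subseteq\mathbb{R}^N$ without isolated points, with $\mathcal{H}^h(E)=0$, such that $\bigcap_{i\in\Lambda}f_i^{-1}(E)\neq\emptyset$ for any countable subset $(f_i)_{i\in\Lambda}\subseteq\mathcal{F}$ (in other words, $E$ contains any countable pattern of $\mathcal{F}$).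
   Context: A dimension function is a function $h:\mathbb{R}_{\ge0}\to\mathbb{R}\cup\{+\infty\}$ that is non-decreasing and right continuous, with $h(0)=0$ and $h(t)>0$ for $t>0$. The associated (outer) Hausdorff measure is $\mathcal{H}^h(E)=\lim_{\delta\to0}\inf\{\sum_i h(|U_i|):\{U_i\}_i\text{ a (countable) }\delta\text{-covering of }E\}$, where $|U|$ is the diameter of $U$ and a $\delta$-covering is a covering by sets of diameter at most $\delta$. A map $g:X\to\mathbb{R}^N$, $X\subseteq\mathbb{R}^N$, is bilipschitz with constants $(c_1,c_2)$, $c_1,c_2>0$, if $c_1\|x-y\|\le\|g(x)-g(y)\|\le c_2\|x-y\|$ for all $x,y\in X$. A map $\psi:\Omega\to\mathbb{R}^N$, $\Omega\subseteq\mathbb{R}^N$, is locally bilipschitz if for every $x_0\in\Omega$ there are $\varepsilon>0$ and $c_1,c_2>0$ (depending on $x_0$) such that $c_1\|x-y\|\le\|\psi(x)-\psi(y)\|\le c_2\|x-y\|$ for all $x,y\in B(x_0,\varepsilon)\cap\Omega$. A map is closed if it sends closed subsets of its domain to closed subsets of its codomain. A set contains arbitrarily large balls if for every $\rho>0$ it contains a ball of $\mathbb{R}^N$ of radius $\rho$. An $\mathcal{F}_\sigma$ set is a countable union of closed sets. A set $E$ contains the pattern $(f_i)_{i\in\Lambda}$ if there is a point $t$ with $f_i(t)\in E$ for all $i\in\Lambda$; the pattern is countable if $\Lambda$ is countable. *)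

theory Defs
  imports "HOL-Analysis.Analysis"
begin

(* Only the values of h on {0..} matter.  A value -\<infinity> is excluded by the sign conditions,
   so on {0..} the codomain ereal stands for the reals together with +\<infinity>. *)
definition dimension_function :: "(real \<Rightarrow> ereal) \<Rightarrow> bool" where
  "dimension_function h \<longleftrightarrow>
     mono_on {0..} h \<and> (\<forall>t\<ge>0. continuous (at_right t) h) \<and> h 0 = 0 \<and> (\<forall>t>0. h t > 0)"

(* Boundedness has to be stated separately because the library's diameter is a real number,
   hence meaningless for unbounded sets.  Finite coverings are padded with empty sets,
   which have diameter 0 and so contribute h 0 = 0 to the sum below. *)
definition delta_covering :: "real \<Rightarrow> 'a::metric_space set \<Rightarrow> (nat \<Rightarrow> 'a set) \<Rightarrow> bool" where
  "delta_covering \<delta> E U \<longleftrightarrow>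
     E \<subseteq> (\<Union>i. U i) \<and> (\<forall>i. bounded (U i) \<and> diameter (U i) \<le> \<delta>)"

definition hausdorff_premeasure ::
    "(real \<Rightarrow> ereal) \<Rightarrow> real \<Rightarrow> 'a::metric_space set \<Rightarrow> ereal" where
  "hausdorff_premeasure h \<delta> E = (INF U\<in>{U. delta_covering \<delta> E U}. \<Sum>i. h (diameter (U i)))"

definition hausdorff_measure :: "(real \<Rightarrow> ereal) \<Rightarrow> 'a::metric_space set \<Rightarrow> ereal" where
  "hausdorff_measure h E = Lim (at_right 0) (\<lambda>\<delta>. hausdorff_premeasure h \<delta> E)"

lemma hausdorff_premeasure_antimono:
  assumes "\<delta> \<le> \<delta>'"
  shows "hausdorff_premeasure h \<delta>' E \<le> hausdorff_premeasure h \<delta> E"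
proof -
  have "delta_covering \<delta>' E U" if "delta_covering \<delta> E U" for U
    using that order_trans[OF _ assms] unfolding delta_covering_def by blast
  then show ?thesis
    unfolding hausdorff_premeasure_def by (intro INF_superset_mono) auto
qed

(* The limit in the definition of hausdorff_measure always exists. *)
lemma tendsto_hausdorff_premeasure:
  "((\<lambda>\<delta>. hausdorff_premeasure h \<delta> E) \<longlongrightarrow> (SUP \<delta>\<in>{0<..}. hausdorff_premeasure h \<delta> E)) (at_right 0)"
proof (rule order_tendstoI)
  fix a assume "a < (SUP \<delta>\<in>{0<..}. hausdorff_premeasure h \<delta> E)"
  then obtain d where d: "d > 0" "a < hausdorff_premeasure h d E"
    by (auto simp: less_SUP_iff)
  have "eventually (\<lambda>\<delta>. \<delta> \<in> {0<..<d}) (at_right (0::real))"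
    using d(1) by (rule eventually_at_right_real)
  then show "eventually (\<lambda>\<delta>. a < hausdorff_premeasure h \<delta> E) (at_right 0)"
  proof eventually_elim
    case (elim \<delta>)
    then show ?case
      using d(2) hausdorff_premeasure_antimono[of \<delta> d h E] by (auto intro: less_le_trans)
  qed
next
  fix a assume a: "(SUP \<delta>\<in>{0<..}. hausdorff_premeasure h \<delta> E) < a"
  show "eventually (\<lambda>\<delta>. hausdorff_premeasure h \<delta> E < a) (at_right 0)"
    using eventually_at_right_less[of "0::real"]
  proof eventually_elim
    case (elim \<delta>)
    then show ?case
      by (intro le_less_trans[OF SUP_upper a]) auto
  qed
qed

lemma hausdorff_measure_eq_SUP:
  "hausdorff_measure h E = (SUP \<delta>\<in>{0<..}. hausdorff_premeasure h \<delta> E)"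
  unfolding hausdorff_measure_def
  by (rule tendsto_Lim[OF _ tendsto_hausdorff_premeasure]) simp

definition bilipschitz_on ::
    "real \<Rightarrow> real \<Rightarrow> 'a::metric_space set \<Rightarrow> ('a \<Rightarrow> 'b::metric_space) \<Rightarrow> bool" where
  "bilipschitz_on c1 c2 X g \<longleftrightarrow> c1 > 0 \<and> c2 > 0 \<and>
     (\<forall>x\<in>X. \<forall>y\<in>X. c1 * dist x y \<le> dist (g x) (g y) \<and> dist (g x) (g y) \<le> c2 * dist x y)"

definition locally_bilipschitz_on ::
    "'a::metric_space set \<Rightarrow> ('a \<Rightarrow> 'b::metric_space) \<Rightarrow> bool" where
  "locally_bilipschitz_on X g \<longleftrightarrow>
     (\<forall>x0\<in>X. \<exists>\<epsilon>>0. \<exists>c1 c2. bilipschitz_on c1 c2 (ball x0 \<epsilon> \<inter> X) g)"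

definition contains_arbitrarily_large_balls :: "'a::metric_space set \<Rightarrow> bool" where
  "contains_arbitrarily_large_balls D \<longleftrightarrow> (\<forall>\<rho>>0. \<exists>x. ball x \<rho> \<subseteq> D)"

end

theory Submission
  imports Defs
begin

text \<open>
  Choose radii \<open>r k\<close> and finite sets \<open>C k\<close> recursively: \<open>C (k + 1)\<close> is a net in the ball of
  radius \<open>k\<close> about the origin, fine on the scale \<open>r k / L\<close>, and \<open>r (k + 1)\<close> is so small that the
  balls of radius \<open>r (k + 1)\<close> about \<open>C (k + 1)\<close>, whose union is \<open>T k\<close>, have negligible total
  \<open>h\<close>-weight.  Then \<open>\<Inter>k\<in>S. T k\<close> is a closed null set for every infinite \<open>S\<close>.  Partition the
  indices into infinitely many infinite classes \<open>S i\<close>, and give the \<open>i\<close>-th map the class \<open>S i\<close>.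
  If \<open>g\<close> is bilipschitz with constants \<open>(1/L, 1)\<close>, invariance of domain shows that the image of a
  ball of radius \<open>r k / 2\<close> contains a point of \<open>C (k + 1)\<close>, so some ball of radius \<open>r (k + 1)\<close> inside
  a given ball of radius \<open>r k\<close> is mapped into \<open>T k\<close>.  Treating at stage \<open>k\<close> the map whose class
  contains \<open>k\<close> gives nested balls, whose common point \<open>t\<close> is sent by the \<open>i\<close>-th map into \<open>T k\<close> for
  all large \<open>k \<in> S i\<close>.  The required set is the union of the preimages under the \<open>\<psi> j\<close> of these
  null sets; adding a countable dense set removes isolated points.
\<close>

section \<open>Dimension functions and countable unions of null sets\<close>

lemma dimension_function_nonneg:
  assumes "dimension_function h" "0 \<le> t"
  shows "0 \<le> h t"
  using assms unfolding dimension_function_def by (cases "t = 0") (auto intro: less_imp_le)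

lemma dimension_function_mono:
  assumes "dimension_function h" "0 \<le> s" "s \<le> t"
  shows "h s \<le> h t"
  using assms unfolding dimension_function_def by (auto intro: mono_onD)

lemma dimension_function_small:
  assumes "dimension_function h" "0 < e"
  obtains d where "0 < d" "h d < e"
proof -
  have "(h \<longlongrightarrow> 0) (at_right 0)"
    using assms(1) unfolding dimension_function_def continuous_within by (metis order_refl)
  then have "\<forall>\<^sub>F t in at_right 0. h t < e"
    using assms(2) by (rule order_tendstoD)
  then obtain b where b: "b > 0" "\<And>t. 0 < t \<Longrightarrow> t < b \<Longrightarrow> h t < e"
    by (auto simp: eventually_at_right[OF zero_less_one])
  then show ?thesis
    by (intro that[of "b / 2"]) auto
qed

text \<open>A supremum of nonnegative premeasures vanishes iff each of them does. The slack
  \<open>e\<close> is there because the infimum over coverings need not be attained.\<close>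

lemma hausdorff_measure_eq_0_iff:
  assumes "dimension_function h"
  shows "hausdorff_measure h E = 0 \<longleftrightarrow>
    (\<forall>\<delta>>0. \<forall>e>0. \<exists>U. delta_covering \<delta> E U \<and> (\<Sum>i. h (diameter (U i))) \<le> ereal e)"
    (is "_ \<longleftrightarrow> ?R")
proof -
  have nonneg: "0 \<le> hausdorff_premeasure h \<delta> E" for \<delta>
    unfolding hausdorff_premeasure_def
    by (auto intro!: INF_greatest suminf_nonneg summable_ereal_pos dimension_function_nonneg[OF assms]
        diameter_ge_0 simp: delta_covering_def)
  show ?thesis
  proof
    assume "hausdorff_measure h E = 0"
    then have le: "hausdorff_premeasure h \<delta> E \<le> 0" if "\<delta> > 0" for \<delta>
      using SUP_upper[of \<delta> "{0<..}" "\<lambda>\<delta>. hausdorff_premeasure h \<delta> E"] that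
      by (simp add: hausdorff_measure_eq_SUP)
    show ?R
    proof (intro allI impI)
      fix \<delta> e :: real assume "\<delta> > 0" "e > 0"
      then have "hausdorff_premeasure h \<delta> E < ereal e"
        using le_less_trans[OF le] by simp
      then show "\<exists>U. delta_covering \<delta> E U \<and> (\<Sum>i. h (diameter (U i))) \<le> ereal e"
        unfolding hausdorff_premeasure_def by (auto simp: INF_less_iff intro: less_imp_le)
    qed
  next
    assume R: ?R
    have "hausdorff_premeasure h \<delta> E \<le> 0" if "\<delta> > 0" for \<delta>
    proof (rule ereal_le_epsilon2)
      fix e :: real assume "e > 0"
      with R that obtain U where U: "delta_covering \<delta> E U" "(\<Sum>i. h (diameter (U i))) \<le> ereal e"
        by blast
      then show "hausdorff_premeasure h \<delta> E \<le> 0 + ereal e"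
        unfolding hausdorff_premeasure_def by (auto intro: INF_lower2)
    qed
    with nonneg have "hausdorff_premeasure h \<delta> E = 0" if "\<delta> > 0" for \<delta>
      using that by (simp add: antisym)
    then show "hausdorff_measure h E = 0"
      by (simp add: hausdorff_measure_eq_SUP)
  qed
qed

text \<open>Used to merge countably many coverings into one sequence. Nonnegativity makes the order
  of summation immaterial, and allows a passage to \<open>ennreal\<close>.\<close>

lemma suminf_ereal_2dimen:
  fixes f :: "nat \<times> nat \<Rightarrow> ereal"
  assumes "\<And>p. 0 \<le> f p"
  shows "(\<Sum>i. f (prod_decode i)) = (\<Sum>m. \<Sum>n. f (m, n))"
proof -
  define g where "g p = e2ennreal (f p)" for p
  have f: "f p = enn2ereal (g p)" for p
    using assms by (simp add: g_def enn2ereal_e2ennreal)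
  show ?thesis
    unfolding f suminf_enn2ereal by (simp add: suminf_ennreal_2dimen[of _ g])
qed

lemma hausdorff_measure_UN_eq_0:
  fixes A :: "nat \<Rightarrow> 'a::metric_space set"
  assumes h: "dimension_function h" and null: "\<And>n. hausdorff_measure h (A n) = 0"
  shows "hausdorff_measure h (\<Union>n. A n) = 0"
  unfolding hausdorff_measure_eq_0_iff[OF h]
proof (intro allI impI)
  fix \<delta> e :: real assume "\<delta> > 0" "e > 0"
  \<comment> \<open>The weights \<open>e / 2 ^ (n + 1)\<close> sum to \<open>e\<close>, so the
    merged covering stays within the budget.\<close>
  then have "\<exists>U. delta_covering \<delta> (A n) U \<and>
      (\<Sum>i. h (diameter (U i))) \<le> ereal (e * (1/2) ^ Suc n)" for n
    using null[of n] unfolding hausdorff_measure_eq_0_iff[OF h] by simp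
  then obtain U where U: "\<And>n. delta_covering \<delta> (A n) (U n)"
    "\<And>n. (\<Sum>i. h (diameter (U n i))) \<le> ereal (e * (1/2) ^ Suc n)"
    by metis
  define V where "V i = (case prod_decode i of (m, n) \<Rightarrow> U m n)" for i
  have cover: "delta_covering \<delta> (\<Union>n. A n) V"
    unfolding delta_covering_def
  proof (intro conjI allI subsetI)
    fix x assume "x \<in> (\<Union>n. A n)"
    then obtain m n where "x \<in> U m n"
      using U(1) unfolding delta_covering_def by blast
    then have "x \<in> V (prod_encode (m, n))"
      by (simp add: V_def)
    then show "x \<in> (\<Union>i. V i)" by blast
  next
    fix i
    show "bounded (V i)" "diameter (V i) \<le> \<delta>"
      using U(1) unfolding V_def delta_covering_def by (auto split: prod.split)
  qed
  have nonneg: "0 \<le> h (diameter (U m n))" for m n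
    using U(1) by (auto intro!: dimension_function_nonneg[OF h] diameter_ge_0 simp: delta_covering_def)
  have "(\<Sum>i. h (diameter (V i))) = (\<Sum>i. (\<lambda>p. h (diameter (U (fst p) (snd p)))) (prod_decode i))"
    by (simp add: V_def split_beta)
  also have "\<dots> = (\<Sum>m. \<Sum>n. h (diameter (U m n)))"
    by (subst suminf_ereal_2dimen) (auto simp: nonneg)
  also have "\<dots> \<le> (\<Sum>m. ereal (e * (1/2) ^ Suc m))"
    using \<open>e > 0\<close>
    by (intro suminf_le U(2) summable_ereal_pos suminf_nonneg nonneg) auto
  also have "\<dots> = ereal e"
    using sums_mult[OF power_half_series, of e] by (intro sums_suminf_ereal) simp
  finally have "(\<Sum>i. h (diameter (V i))) \<le> ereal e" .
  with cover show "\<exists>U. delta_covering \<delta> (\<Union>n. A n) U \<and> (\<Sum>i. h (diameter (U i))) \<le> ereal e"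
    by blast
qed

lemma hausdorff_measure_countable_Union_eq_0:
  fixes \<A> :: "'a::metric_space set set"
  assumes h: "dimension_function h" and "countable \<A>"
    and null: "\<And>A. A \<in> \<A> \<Longrightarrow> hausdorff_measure h A = 0"
  shows "hausdorff_measure h (\<Union>\<A>) = 0"
proof -
  have "hausdorff_measure h ({} :: 'a set) = 0"
    using h unfolding hausdorff_measure_eq_0_iff[OF h]
    by (auto intro!: exI[of _ "\<lambda>_. {}"] simp: delta_covering_def dimension_function_def)
  \<comment> \<open>The empty set is added so that \<open>from_nat_into\<close> enumerates a
    nonempty family; the union is unchanged.\<close>
  then have null': "hausdorff_measure h A = 0" if "A \<in> insert {} \<A>" for A
    using that null by auto
  have "hausdorff_measure h (\<Union>n. from_nat_into (insert {} \<A>) n) = 0"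
    by (intro hausdorff_measure_UN_eq_0[OF h] null' from_nat_into) simp
  moreover have "range (from_nat_into (insert {} \<A>)) = insert {} \<A>"
    using \<open>countable \<A>\<close> by (intro range_from_nat_into) auto
  ultimately show ?thesis by simp
qed

lemma hausdorff_measure_countable_eq_0:
  assumes h: "dimension_function h" and "countable A"
  shows "hausdorff_measure h A = 0"
proof -
  have "hausdorff_measure h {x} = 0" for x :: 'a
    using h unfolding hausdorff_measure_eq_0_iff[OF h]
    by (auto intro!: exI[of _ "\<lambda>_. {x}"] simp: delta_covering_def dimension_function_def)
  then have "hausdorff_measure h (\<Union>((\<lambda>x. {x}) ` A)) = 0"
    using \<open>countable A\<close> by (intro hausdorff_measure_countable_Union_eq_0[OF h]) auto
  then show ?thesis by simp
qed

section \<open>Null sets that survive Lipschitz maps\<close>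

text \<open>A null set for \<open>h\<close> need not stay null under Lipschitz maps, since \<open>h (K * t)\<close> is not
  controlled by \<open>h t\<close>.  The following strengthening, with the factor \<open>K\<close> built in, does survive.\<close>

definition scaled_null :: "(real \<Rightarrow> ereal) \<Rightarrow> 'a::metric_space set \<Rightarrow> bool" where
  "scaled_null h A \<longleftrightarrow>
     (\<forall>K\<ge>0. \<forall>\<delta>>0. \<forall>e>0. \<exists>C r. finite C \<and> 0 \<le> r \<and> A \<subseteq> (\<Union>c\<in>C. cball c r) \<and>
        K * (2 * r) \<le> \<delta> \<and> (\<Sum>c\<in>C. h (K * (2 * r))) \<le> ereal e)"

text \<open>The part of \<open>A\<close> in a ball of radius \<open>r\<close> has an image of
  diameter at most \<open>K * (2 * r)\<close>, exactly the argument at which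
  \<open>scaled_null\<close> controls \<open>h\<close>.\<close>

lemma scaled_null_Lipschitz_image:
  fixes \<phi> :: "'a::metric_space \<Rightarrow> 'b::real_normed_vector"
  assumes h: "dimension_function h" and A: "scaled_null h A" and "K \<ge> 0"
    and lip: "\<And>x y. x \<in> A \<Longrightarrow> y \<in> A \<Longrightarrow> dist (\<phi> x) (\<phi> y) \<le> K * dist x y"
  shows "hausdorff_measure h (\<phi> ` A) = 0"
  unfolding hausdorff_measure_eq_0_iff[OF h]
proof (intro allI impI)
  fix \<delta> e :: real assume "\<delta> > 0" "e > 0"
  then obtain C r where C: "finite C" "0 \<le> r" "A \<subseteq> (\<Union>c\<in>C. cball c r)" "K * (2 * r) \<le> \<delta>"
    "(\<Sum>c\<in>C. h (K * (2 * r))) \<le> ereal e"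
    using A \<open>K \<ge> 0\<close> unfolding scaled_null_def by meson
  obtain q where q: "bij_betw q {0..<card C} C"
    using ex_bij_betw_nat_finite[OF C(1)] by blast
  \<comment> \<open>A covering is a sequence: after the finitely many images come empty sets, which
    contribute \<open>h 0 = 0\<close>.\<close>
  define U where "U i = (if i < card C then \<phi> ` (A \<inter> cball (q i) r) else {})" for i
  have close: "norm (u - v) \<le> K * (2 * r)" if uv: "u \<in> U i" "v \<in> U i" for u v i
  proof -
    obtain x y where xy: "x \<in> A" "y \<in> A" "dist (q i) x \<le> r" "dist (q i) y \<le> r" "u = \<phi> x" "v = \<phi> y"
      using uv by (auto simp: U_def split: if_splits)
    have "dist x y \<le> 2 * r"
      using dist_triangle3[of x y "q i"] xy by simp
    then show ?thesis
      using lip[of x y] xy \<open>K \<ge> 0\<close> by (auto simp: dist_norm intro: order_trans mult_left_mono)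
  qed
  have K2r: "0 \<le> K * (2 * r)"
    using \<open>K \<ge> 0\<close> C(2) by simp
  have diam: "diameter (U i) \<le> K * (2 * r)" for i
    using K2r by (intro diameter_le close) auto
  have bdd: "bounded (U i)" for i
    unfolding bounded_two_points dist_norm using close by blast
  have "delta_covering \<delta> (\<phi> ` A) U"
    unfolding delta_covering_def
  proof (intro conjI allI subsetI bdd)
    fix u assume "u \<in> \<phi> ` A"
    then obtain x where x: "x \<in> A" "u = \<phi> x" by blast
    then obtain c where c: "c \<in> C" "x \<in> cball c r"
      using C(3) by blast
    then obtain i where "i < card C" "q i = c"
      using q unfolding bij_betw_def by (metis atLeastLessThan_iff imageE)
    then have "u \<in> U i"
      using x c by (auto simp: U_def)
    then show "u \<in> (\<Union>i. U i)" by blast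
  next
    show "diameter (U i) \<le> \<delta>" for i
      using diam C(4) by (rule order_trans)
  qed
  moreover have "(\<Sum>i. h (diameter (U i))) = (\<Sum>i\<in>{0..<card C}. h (diameter (U i)))"
    using h by (intro suminf_finite) (auto simp: U_def dimension_function_def)
  moreover have "\<dots> \<le> (\<Sum>i\<in>{0..<card C}. h (K * (2 * r)))"
    by (intro sum_mono dimension_function_mono[OF h] diam diameter_ge_0 bdd)
  moreover have "\<dots> = (\<Sum>c\<in>C. h (K * (2 * r)))"
    by (rule sum.reindex_bij_betw[OF q, of "\<lambda>_. h (K * (2 * r))"])
  ultimately show "\<exists>U. delta_covering \<delta> (\<phi> ` A) U \<and> (\<Sum>i. h (diameter (U i))) \<le> ereal e"
    using C(5) by (metis order_trans)
qed

lemma scaled_null_subset: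
  assumes "scaled_null h B" "A \<subseteq> B"
  shows "scaled_null h A"
  unfolding scaled_null_def
proof (intro allI impI)
  fix K \<delta> e :: real assume "K \<ge> 0" "\<delta> > 0" "e > 0"
  then obtain C r where "finite C" "0 \<le> r" "B \<subseteq> (\<Union>c\<in>C. cball c r)" "K * (2 * r) \<le> \<delta>"
    "(\<Sum>c\<in>C. h (K * (2 * r))) \<le> ereal e"
    using assms(1) unfolding scaled_null_def by meson
  then show "\<exists>C r. finite C \<and> 0 \<le> r \<and> A \<subseteq> (\<Union>c\<in>C. cball c r) \<and>
      K * (2 * r) \<le> \<delta> \<and> (\<Sum>c\<in>C. h (K * (2 * r))) \<le> ereal e"
    using order_trans[OF assms(2)] by (intro exI[of _ C] exI[of _ r] conjI)
qed

section \<open>F-sigma sets and images of balls\<close>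

text \<open>Makes the closure of \<open>fsigma_in\<close> under countable unions usable for
  \<open>fsigma\<close>.\<close>

lemma fsigma_iff_fsigma_in: "fsigma S \<longleftrightarrow> fsigma_in euclidean S"
proof
  assume "fsigma S"
  then show "fsigma_in euclidean S"
    by cases (auto intro!: fsigma_in_Union intro: closed_imp_fsigma_in)
next
  assume "fsigma_in euclidean S"
  then show "fsigma S"
    unfolding fsigma_in_ascending by (metis closed_closedin fsigma.intros)
qed

text \<open>By invariance of domain the image of the open ball is open, while that of the closed
  ball is compact. Points of the bounding sphere go to distance at least \<open>c * R\<close> from
  \<open>g x\<close>, so inside \<open>ball (g x) (c * R)\<close> the two images agree. Being
  nonempty, open and closed in this connected set, the image fills it.\<close>

lemma ball_subset_image_of_expanding:
  fixes g :: "'a::euclidean_space \<Rightarrow> 'a"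
  assumes cont: "continuous_on (cball x R) g" and "0 < R" "0 < c"
    and exp: "\<And>y z. y \<in> cball x R \<Longrightarrow> z \<in> cball x R \<Longrightarrow> c * dist y z \<le> dist (g y) (g z)"
  shows "ball (g x) (c * R) \<subseteq> g ` ball x R"
proof -
  let ?V = "ball (g x) (c * R)" and ?U = "g ` ball x R" and ?K = "g ` cball x R"
  have "inj_on g (cball x R)"
  proof (rule inj_onI)
    fix y z assume "y \<in> cball x R" "z \<in> cball x R" "g y = g z"
    then have "c * dist y z \<le> 0" using exp by fastforce
    then show "y = z" using \<open>0 < c\<close> by (simp add: mult_le_0_iff)
  qed
  then have "open ?U"
    using ball_subset_cball[of x R] continuous_on_subset[OF cont] inj_on_subset
    by (intro invariance_of_domain) blast+
  have "closed ?K"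
    using cont by (intro compact_imp_closed compact_continuous_image) auto
  have VK: "?V \<inter> ?K \<subseteq> ?U"
  proof
    fix u assume "u \<in> ?V \<inter> ?K"
    then obtain y where y: "y \<in> cball x R" "u = g y" "dist (g x) (g y) < c * R"
      by auto
    have "c * dist x y < c * R"
      using exp[of x y] y \<open>0 < R\<close> by simp
    then show "u \<in> ?U"
      using y \<open>0 < c\<close> by auto
  qed
  have "?U \<inter> ?V = {} \<or> - ?K \<inter> ?V = {}"
    using VK \<open>open ?U\<close> \<open>closed ?K\<close> ball_subset_cball[of x R] by (intro connectedD) auto
  moreover have "g x \<in> ?U \<inter> ?V"
    using \<open>0 < R\<close> \<open>0 < c\<close> by auto
  ultimately show ?thesis
    using VK by blast
qed

section \<open>Construction of the universal null sets\<close>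

text \<open>\<open>C (k + 1)\<close> depends on \<open>r k\<close>, and \<open>r (k + 1)\<close> on
  \<open>C (k + 1)\<close>, so the pairs come from dependent choice. The factor \<open>Suc k\<close>
  inside \<open>h\<close> eventually exceeds any Lipschitz constant \<open>K\<close>, as
  \<open>scaled_null\<close> demands.\<close>

lemma exists_scales:
  assumes h: "dimension_function h" and "0 < c"
  obtains r :: "nat \<Rightarrow> real" and C :: "nat \<Rightarrow> 'a::euclidean_space set" where
    "\<And>k. 0 < r k" "r 0 \<le> 1" "\<And>k. r (Suc k) \<le> r k / 2" "\<And>k. finite (C k)"
    "\<And>k. real (Suc k) * (2 * r k) \<le> 1 / real (Suc k)"
    "\<And>k. (\<Sum>y\<in>C k. h (real (Suc k) * (2 * r k))) \<le> ereal (1 / real (Suc k))"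
    "\<And>k. cball 0 (real k) \<subseteq> (\<Union>y\<in>C (Suc k). ball y (c * (r k / 2)))"
proof -
  define P where "P k x \<longleftrightarrow> 0 < snd x \<and> snd x \<le> 1 \<and> finite (fst x) \<and>
    real (Suc k) * (2 * snd x) \<le> 1 / real (Suc k) \<and>
    (\<Sum>y\<in>fst x. h (real (Suc k) * (2 * snd x))) \<le> ereal (1 / real (Suc k))"
    for k and x :: "'a set \<times> real"
  define Q where "Q k x x' \<longleftrightarrow> snd x' \<le> snd x / 2 \<and>
    cball 0 (real k) \<subseteq> (\<Union>y\<in>fst x'. ball y (c * (snd x / 2)))" for k and x x' :: "'a set \<times> real"
  have radius: "\<exists>r\<le>b. P k (B, r)" if "finite B" "0 < b" for B k b
  proof -
    \<comment> \<open>The budget \<open>1 / Suc k\<close> is split among the \<open>card B\<close>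
      balls; the second \<open>Suc\<close> keeps the divisor nonzero when \<open>B\<close> is
      empty.\<close>
    define a where "a = 1 / (real (Suc k) * real (Suc (card B)))"
    have "0 < a" by (simp add: a_def)
    then obtain d where d: "0 < d" "h d < ereal a"
      using dimension_function_small[OF h, of "ereal a"] by auto
    \<comment> \<open>\<open>s\<close> is the scaled diameter at which \<open>h\<close> is
      evaluated; dividing it by \<open>2 * Suc k\<close> gives the radius.\<close>
    define s where "s = Min {d, 1 / real (Suc k), b, 1}"
    have s: "0 < s" "s \<le> d" "s \<le> 1 / real (Suc k)" "s \<le> b" "s \<le> 1"
      using d \<open>0 < b\<close> by (auto simp: s_def)
    define r where "r = s / (2 * real (Suc k))"
    have r: "real (Suc k) * (2 * r) = s"
      unfolding r_def by (simp del: of_nat_Suc)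
    have "0 < r" "r \<le> s"
      using \<open>0 < s\<close> by (auto simp: r_def field_simps)
    have "h s \<le> ereal a"
      using dimension_function_mono[OF h, of s d] d s by (simp add: order.trans less_imp_le)
    then have "(\<Sum>y\<in>B. h s) \<le> (\<Sum>y\<in>B. ereal a)"
      by (intro sum_mono)
    also have "\<dots> = ereal (real (card B) * a)"
      by (simp add: sum_ereal del: sum_constant) simp
    also have "\<dots> \<le> ereal (1 / real (Suc k))"
    proof -
      have "real (card B) * a = real (card B) / real (Suc (card B)) * (1 / real (Suc k))"
        by (simp add: a_def)
      also have "\<dots> \<le> 1 * (1 / real (Suc k))"
        by (intro mult_right_mono) auto
      finally show ?thesis by simp
    qed
    finally show ?thesis
      using s \<open>0 < r\<close> \<open>r \<le> s\<close> \<open>finite B\<close>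
      by (intro exI[of _ r]) (simp add: P_def r del: of_nat_Suc)
  qed
  have "\<exists>f. \<forall>k. P k (f k) \<and> Q k (f k) (f (Suc k))"
  proof (rule dependent_nat_choice)
    show "\<exists>x. P 0 x"
      using radius[of "{}" 1 0] by auto
  next
    fix x k assume "P k x"
    then have pos: "0 < c * (snd x / 2)"
      using \<open>0 < c\<close> by (simp add: P_def)
    \<comment> \<open>Balls about all points cover the compact ball; the centres of a finite
      subcover form the net.\<close>
    have "cball 0 (real k) \<subseteq> (\<Union>y\<in>UNIV. ball (y :: 'a) (c * (snd x / 2)))"
      using pos centre_in_ball by blast
    then obtain B where B: "finite B"
      "cball (0 :: 'a) (real k) \<subseteq> (\<Union>y\<in>B. ball y (c * (snd x / 2)))"
      by (rule compactE_image[OF compact_cball open_ball])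
    obtain r where "r \<le> snd x / 2" "P (Suc k) (B, r)"
      using radius[OF B(1), of "snd x / 2" "Suc k"] \<open>P k x\<close> by (auto simp: P_def)
    with B show "\<exists>y. P (Suc k) y \<and> Q k x y"
      by (intro exI[of _ "(B, r)"]) (simp add: Q_def)
  qed
  then obtain f where f: "\<And>k. P k (f k)" "\<And>k. Q k (f k) (f (Suc k))" by blast
  show thesis
    using f unfolding P_def Q_def by (intro that[of "snd \<circ> f" "fst \<circ> f"]) auto
qed

text \<open>The net of stage \<open>k\<close> only reaches norm \<open>k\<close>, so the map
  numbered \<open>i\<close> can be steered into \<open>T k\<close> only for large \<open>k\<close>.
  How large depends on the map, while the sets are fixed beforehand; hence the second index
  \<open>m\<close>, the stage from which the intersection starts.\<close>

lemma exists_scaled_null_universal: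
  assumes h: "dimension_function h" and "0 < c"
  obtains A :: "nat \<Rightarrow> nat \<Rightarrow> 'a::euclidean_space set" where
    "\<And>i m. closed (A i m)" "\<And>i m. scaled_null h (A i m)"
    "\<And>(x0 :: 'a) g. (\<And>i. bilipschitz_on c 1 (cball x0 1) (g i)) \<Longrightarrow>
       \<exists>t\<in>cball x0 1. \<forall>i. \<exists>m. g i t \<in> A i m"
proof -
  obtain r and C :: "nat \<Rightarrow> 'a set" where
    r: "\<And>k. 0 < r k" "r 0 \<le> 1" "\<And>k. r (Suc k) \<le> r k / 2" and C: "\<And>k. finite (C k)"
    and small: "\<And>k. real (Suc k) * (2 * r k) \<le> 1 / real (Suc k)"
      "\<And>k. (\<Sum>y\<in>C k. h (real (Suc k) * (2 * r k))) \<le> ereal (1 / real (Suc k))"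
    and net: "\<And>k. cball 0 (real k) \<subseteq> (\<Union>y\<in>C (Suc k). ball y (c * (r k / 2)))"
    using exists_scales[OF h \<open>0 < c\<close>] by metis
  \<comment> \<open>\<open>\<tau> k\<close> is the number of the map treated at stage
    \<open>k\<close>; every value is taken infinitely often.\<close>
  define \<tau> where "\<tau> k = fst (prod_decode k)" for k
  define T where "T k = (\<Union>y\<in>C (Suc k). cball y (r (Suc k)))" for k
  define A where "A i m = (\<Inter>k\<in>{k. m \<le> k \<and> \<tau> k = i}. T k)" for i m
  have "closed (A i m)" for i m
    unfolding A_def T_def using C by (intro closed_INT closed_UN ballI closed_cball) auto
  moreover have "scaled_null h (A i m)" for i m
    unfolding scaled_null_def
  proof (intro allI impI)
    fix K \<delta> e :: real assume "K \<ge> 0" "\<delta> > 0" "e > 0"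
    obtain n where n: "m \<le> n" "K \<le> real n" "1 / \<delta> \<le> real n" "1 / e \<le> real n"
      using real_arch_simple[of "Max {real m, K, 1 / \<delta>, 1 / e}"] by auto
    \<comment> \<open>This stage belongs to the class of \<open>i\<close> and is at least
      \<open>n\<close>. Its \<open>T k\<close> alone gives the required covering of
      \<open>A i m\<close>.\<close>
    define k where "k = prod_encode (i, n)"
    have "n \<le> k" "\<tau> k = i"
      by (auto simp: k_def \<tau>_def le_prod_encode_2)
    then have sub: "A i m \<subseteq> T k"
      using n(1) unfolding A_def by auto
    let ?k = "real (Suc (Suc k))"
    have k: "K \<le> ?k" "1 / \<delta> \<le> ?k" "1 / e \<le> ?k"
      using n \<open>n \<le> k\<close> by auto
    then have ke: "1 / ?k \<le> \<delta>" "1 / ?k \<le> e"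
      using \<open>\<delta> > 0\<close> \<open>e > 0\<close> by (simp_all add: field_simps)
    have Kr: "0 \<le> K * (2 * r (Suc k))" "K * (2 * r (Suc k)) \<le> ?k * (2 * r (Suc k))"
      using \<open>K \<ge> 0\<close> k(1) r(1)[of "Suc k"] by (simp, intro mult_right_mono) auto
    have "(\<Sum>y\<in>C (Suc k). h (K * (2 * r (Suc k)))) \<le> (\<Sum>y\<in>C (Suc k). h (?k * (2 * r (Suc k))))"
      by (intro sum_mono dimension_function_mono[OF h] Kr)
    also have "\<dots> \<le> ereal e"
      using small(2)[of "Suc k"] ke(2) by (meson ereal_less_eq(3) order_trans)
    finally have "(\<Sum>y\<in>C (Suc k). h (K * (2 * r (Suc k)))) \<le> ereal e" .
    moreover have "K * (2 * r (Suc k)) \<le> \<delta>"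
      using Kr(2) small(1)[of "Suc k"] ke(1) by linarith
    ultimately show "\<exists>C r. finite C \<and> 0 \<le> r \<and> A i m \<subseteq> (\<Union>c\<in>C. cball c r) \<and>
        K * (2 * r) \<le> \<delta> \<and> (\<Sum>c\<in>C. h (K * (2 * r))) \<le> ereal e"
      using sub C[of "Suc k"] less_imp_le[OF r(1)[of "Suc k"]] unfolding T_def by blast
  qed
  moreover have "\<exists>t\<in>cball x0 1. \<forall>i. \<exists>m. g i t \<in> A i m"
    if bil: "\<And>i. bilipschitz_on c 1 (cball x0 1) (g i)" for x0 and g :: "nat \<Rightarrow> 'a \<Rightarrow> 'a"
  proof -
    have lip: "dist (g i y) (g i z) \<le> dist y z" and exp: "c * dist y z \<le> dist (g i y) (g i z)"
      if "y \<in> cball x0 1" "z \<in> cball x0 1" for i y z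
      using bil[of i] that unfolding bilipschitz_on_def by auto
    \<comment> \<open>Being 1-Lipschitz, \<open>g i\<close> keeps the unit ball about
      \<open>x0\<close> within norm \<open>norm (g i x0) + 1\<close>, where the net is available
      from stage \<open>m i\<close> on.\<close>
    have "\<exists>m::nat. norm (g i x0) + 1 \<le> real m" for i
      by (rule real_arch_simple)
    then obtain m where m: "\<And>i. norm (g i x0) + 1 \<le> real (m i)" by metis
    have "\<exists>f. \<forall>k. cball (f k) (r k) \<subseteq> cball x0 1 \<and>
      (cball (f (Suc k)) (r (Suc k)) \<subseteq> cball (f k) (r k) \<and>
       (m (\<tau> k) \<le> k \<longrightarrow> g (\<tau> k) ` cball (f (Suc k)) (r (Suc k)) \<subseteq> T k))"
    proof (rule dependent_nat_choice)
      show "\<exists>x. cball x (r 0) \<subseteq> cball x0 1"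
        using r(2) subset_cball by blast
    next
      fix x k assume x: "cball x (r k) \<subseteq> cball x0 1"
      let ?g = "g (\<tau> k)"
      \<comment> \<open>Moving the centre by at most half the radius makes its image a net point;
        the other half leaves room for the next ball, since
        \<open>r (Suc k) \<le> r k / 2\<close>.\<close>
      have "\<exists>x'. dist x x' \<le> r k / 2 \<and> (m (\<tau> k) \<le> k \<longrightarrow> ?g x' \<in> C (Suc k))"
      proof (cases "m (\<tau> k) \<le> k")
        case True
        have half: "cball x (r k / 2) \<subseteq> cball x0 1"
          using x r(1)[of k] subset_cball[of "r k / 2" "r k" x] by auto
        have "x \<in> cball x0 1"
          using half r(1)[of k] by (meson centre_in_cball half_gt_zero less_imp_le subsetD)
        then have "norm (?g x) \<le> norm (?g x0) + 1"
          using lip[of x x0 "\<tau> k"] norm_triangle_sub[of "?g x" "?g x0"]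
          by (simp add: dist_norm norm_minus_commute)
        also have "\<dots> \<le> real k"
          using m[of "\<tau> k"] True by linarith
        finally obtain y where y: "y \<in> C (Suc k)" "?g x \<in> ball y (c * (r k / 2))"
          using net[of k] by auto
        have "continuous_on (cball x (r k / 2)) ?g"
          unfolding continuous_on_iff using lip half by (meson le_less_trans subsetD)
        then have "ball (?g x) (c * (r k / 2)) \<subseteq> ?g ` ball x (r k / 2)"
          using r(1)[of k] \<open>0 < c\<close> half by (intro ball_subset_image_of_expanding exp) auto
        moreover have "y \<in> ball (?g x) (c * (r k / 2))"
          using y(2) by (simp add: dist_commute)
        ultimately obtain x' where "x' \<in> ball x (r k / 2)" "y = ?g x'"
          by blast
        then show ?thesis
          using y(1) by (intro exI[of _ x']) auto
      qed (use r(1)[of k] in \<open>auto intro!: exI[of _ x]\<close>)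
      then obtain x' where x': "dist x x' \<le> r k / 2" "m (\<tau> k) \<le> k \<Longrightarrow> ?g x' \<in> C (Suc k)"
        by blast
      have sub: "cball x' (r (Suc k)) \<subseteq> cball x (r k)"
        using x'(1) r(3)[of k] by (simp add: cball_subset_cball_iff dist_commute)
      have x'mem: "x' \<in> cball x (r k)"
        using sub r(1)[of "Suc k"] by (meson centre_in_cball less_imp_le subsetD)
      have "?g ` cball x' (r (Suc k)) \<subseteq> T k" if "m (\<tau> k) \<le> k"
      proof
        fix u assume "u \<in> ?g ` cball x' (r (Suc k))"
        then obtain z where z: "z \<in> cball x' (r (Suc k))" "u = ?g z" by blast
        then have "dist (?g x') u \<le> r (Suc k)"
          using lip[of x' z "\<tau> k"] sub x x'mem by fastforce
        then show "u \<in> T k"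
          using x'(2)[OF that] unfolding T_def by auto
      qed
      with sub x show "\<exists>y. cball y (r (Suc k)) \<subseteq> cball x0 1 \<and>
          cball y (r (Suc k)) \<subseteq> cball x (r k) \<and>
          (m (\<tau> k) \<le> k \<longrightarrow> ?g ` cball y (r (Suc k)) \<subseteq> T k)"
        by (intro exI[of _ x']) auto
    qed
    then obtain f where "\<forall>k. cball (f k) (r k) \<subseteq> cball x0 1 \<and>
      (cball (f (Suc k)) (r (Suc k)) \<subseteq> cball (f k) (r k) \<and>
       (m (\<tau> k) \<le> k \<longrightarrow> g (\<tau> k) ` cball (f (Suc k)) (r (Suc k)) \<subseteq> T k))" ..
    then have f: "cball (f k) (r k) \<subseteq> cball x0 1"
      "cball (f (Suc k)) (r (Suc k)) \<subseteq> cball (f k) (r k)"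
      "m (\<tau> k) \<le> k \<Longrightarrow> g (\<tau> k) ` cball (f (Suc k)) (r (Suc k)) \<subseteq> T k" for k
      by simp_all
    have "cball (f l) (r l) \<subseteq> cball (f k) (r k)" if "k \<le> l" for k l
      using f(2) that by (rule lift_Suc_antimono_le)
    moreover have "cball (f k) (r k) \<noteq> {}" for k
      using r(1)[of k] by simp
    ultimately have "\<Inter>(range (\<lambda>k. cball (f k) (r k))) \<noteq> {}"
      by (intro compact_nest compact_cball)
    then obtain t where "t \<in> \<Inter>(range (\<lambda>k. cball (f k) (r k)))"
      unfolding ex_in_conv[symmetric] ..
    then have t: "t \<in> cball (f k) (r k)" for k
      by (rule INT_D) simp
    \<comment> \<open>It is membership of \<open>t\<close> in ball number \<open>k + 1\<close>, not
      \<open>k\<close>, that puts its image in \<open>T k\<close>.\<close>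
    have "g i t \<in> A i (m i)" for i
      unfolding A_def
    proof (rule INT_I)
      fix k assume "k \<in> {k. m i \<le> k \<and> \<tau> k = i}"
      then show "g i t \<in> T k"
        using f(3)[of k] t[of "Suc k"] by auto
    qed
    moreover have "t \<in> cball x0 1"
      using f(1)[of 0] t[of 0] by (rule subsetD)
    ultimately show ?thesis by blast
  qed
  ultimately show thesis
    by (rule that)
qed

section \<open>Pulling back by \<psi> and assembling the F-sigma set\<close>

text \<open>The Lipschitz constant of the inverse varies from point to point. By Lindelof, countably
  many of the balls on which it is Lipschitz cover the image of \<psi>, and on each of them the
  inverse carries its part of \<open>A\<close> to a null set.\<close>

lemma scaled_null_vimage_locally_Lipschitz_inverse:
  fixes \<psi> :: "'a::euclidean_space \<Rightarrow> 'b::euclidean_space"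
  assumes h: "dimension_function h" and A: "scaled_null h A" and "inj_on \<psi> \<Omega>"
    and loc: "locally_bilipschitz_on (\<psi> ` \<Omega>) (inv_into \<Omega> \<psi>)"
  shows "hausdorff_measure h (\<Omega> \<inter> \<psi> -` A) = 0"
proof -
  let ?\<phi> = "inv_into \<Omega> \<psi>"
  have "\<forall>y\<in>\<psi> ` \<Omega>. \<exists>e>0. \<exists>c1 c2. bilipschitz_on c1 c2 (ball y e \<inter> \<psi> ` \<Omega>) ?\<phi>"
    using loc unfolding locally_bilipschitz_on_def .
  then obtain e c1 c2 where e: "\<And>y. y \<in> \<psi> ` \<Omega> \<Longrightarrow> 0 < e y"
    "\<And>y. y \<in> \<psi> ` \<Omega> \<Longrightarrow> bilipschitz_on (c1 y) (c2 y) (ball y (e y) \<inter> \<psi> ` \<Omega>) ?\<phi>"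
    by metis
  obtain \<B> where \<B>: "\<B> \<subseteq> (\<lambda>y. ball y (e y)) ` (\<psi> ` \<Omega>)" "countable \<B>"
    "\<Union>\<B> = (\<Union>y\<in>\<psi> ` \<Omega>. ball y (e y))"
    using Lindelof[of "(\<lambda>y. ball y (e y)) ` (\<psi> ` \<Omega>)"] by (metis (no_types, lifting) image_iff open_ball)
  have "hausdorff_measure h (?\<phi> ` (A \<inter> (B \<inter> \<psi> ` \<Omega>))) = 0" if B: "B \<in> \<B>" for B
  proof -
    obtain y where "B = ball y (e y)" "y \<in> \<psi> ` \<Omega>"
      using subsetD[OF \<B>(1) B] by (rule imageE)
    then have "bilipschitz_on (c1 y) (c2 y) (B \<inter> \<psi> ` \<Omega>) ?\<phi>"
      using e(2)[of y] by blast
    then show ?thesis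
      by (intro scaled_null_Lipschitz_image[OF h scaled_null_subset[OF A], of _ "c2 y"])
        (auto simp: bilipschitz_on_def)
  qed
  then have "hausdorff_measure h (\<Union>((\<lambda>B. ?\<phi> ` (A \<inter> (B \<inter> \<psi> ` \<Omega>))) ` \<B>)) = 0"
    using \<B>(2) by (intro hausdorff_measure_countable_Union_eq_0[OF h]) auto
  \<comment> \<open>As \<psi> is injective, its preimages are the images under the inverse, one ball
    of the cover at a time.\<close>
  also have "(\<Union>((\<lambda>B. ?\<phi> ` (A \<inter> (B \<inter> \<psi> ` \<Omega>))) ` \<B>)) = \<Omega> \<inter> \<psi> -` A"
  proof -
    have cover: "\<Omega> \<subseteq> \<psi> -` \<Union>\<B>"
    proof
      fix x assume "x \<in> \<Omega>"
      then have "\<psi> x \<in> ball (\<psi> x) (e (\<psi> x))"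
        using e(1)[of "\<psi> x"] by simp
      then show "x \<in> \<psi> -` \<Union>\<B>"
        using \<open>x \<in> \<Omega>\<close> unfolding \<B>(3) by blast
    qed
    have "?\<phi> ` (A \<inter> (B \<inter> \<psi> ` \<Omega>)) = \<Omega> \<inter> \<psi> -` A \<inter> \<psi> -` B" for B
    proof
      show "\<Omega> \<inter> \<psi> -` A \<inter> \<psi> -` B \<subseteq> ?\<phi> ` (A \<inter> (B \<inter> \<psi> ` \<Omega>))"
        by (auto simp: inv_into_f_f[OF \<open>inj_on \<psi> \<Omega>\<close>] intro!: image_eqI[of _ ?\<phi> "\<psi> _"])
    qed (auto simp: inv_into_f_f[OF \<open>inj_on \<psi> \<Omega>\<close>])
    then have "(\<Union>((\<lambda>B. ?\<phi> ` (A \<inter> (B \<inter> \<psi> ` \<Omega>))) ` \<B>)) = \<Omega> \<inter> \<psi> -` A \<inter> \<psi> -` \<Union>\<B>"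
      by (simp only:) auto
    with cover show ?thesis by (simp only:) blast
  qed
  finally show ?thesis .
qed

theorem theorem4p4:
  fixes h :: "real \<Rightarrow> ereal"
    and D :: "(real ^ 'n) set"
    and F :: "(real ^ 'n \<Rightarrow> real ^ 'n) set"
    and L :: int
    and \<Omega> :: "nat \<Rightarrow> (real ^ 'n) set"
    and \<psi> :: "nat \<Rightarrow> real ^ 'n \<Rightarrow> real ^ 'n"
  assumes "dimension_function h"
    and "closed D"
    and "contains_arbitrarily_large_balls D"
    and "\<And>f. f \<in> F \<Longrightarrow> continuous_on D f"
    and "L \<ge> 2"
    and "\<And>j. closed (\<Omega> j)"
    and "\<And>j. continuous_on (\<Omega> j) (\<psi> j)"
    and "\<And>j. inj_on (\<psi> j) (\<Omega> j)"
    and "\<And>j. closed_map (top_of_set (\<Omega> j)) euclidean (\<psi> j)"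
    and "\<And>j. locally_bilipschitz_on (\<psi> j ` \<Omega> j) (inv_into (\<Omega> j) (\<psi> j))"
    and "\<And>f. f \<in> F \<Longrightarrow>
           \<exists>j. f ` D \<subseteq> \<Omega> j \<and> bilipschitz_on (1 / real_of_int L) 1 D (\<psi> j \<circ> f)"
  shows "\<exists>E :: (real ^ 'n) set.
           fsigma E \<and> (\<forall>x\<in>E. \<not> x isolated_in E) \<and> hausdorff_measure h E = 0 \<and>
           (\<forall>G \<subseteq> F. countable G \<longrightarrow> D \<inter> (\<Inter>f\<in>G. f -` E) \<noteq> {})"
proof -
  note h = assms(1)
  \<comment> \<open>Radius 2 leaves room for the closed unit ball on which the nested balls are
    chosen.\<close>
  obtain x0 where "ball x0 2 \<subseteq> D"
    using assms(3) unfolding contains_arbitrarily_large_balls_def by (meson zero_less_numeral)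
  then have x0: "cball x0 1 \<subseteq> D"
    by (auto simp: subset_iff)
  obtain A :: "nat \<Rightarrow> nat \<Rightarrow> (real ^ 'n) set" where
    A: "\<And>i m. closed (A i m)" "\<And>i m. scaled_null h (A i m)"
    and univ: "\<And>(x0 :: real ^ 'n) g. (\<And>i. bilipschitz_on (1 / real_of_int L) 1 (cball x0 1) (g i)) \<Longrightarrow>
       \<exists>t\<in>cball x0 1. \<forall>i. \<exists>m. g i t \<in> A i m"
    by (rule exists_scaled_null_universal[OF h, of "1 / real_of_int L"])
      (use \<open>L \<ge> 2\<close> in auto)
  obtain Q :: "(real ^ 'n) set" where
    Q: "countable Q" "\<And>X. open X \<Longrightarrow> X \<noteq> {} \<Longrightarrow> \<exists>d\<in>Q. d \<in> X"
    using countable_dense_exists[where 'a = "real ^ 'n"] by auto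
  \<comment> \<open>Which \<open>\<psi> j\<close> will accompany the map numbered \<open>i\<close>
    depends on the pattern, so all triples enter; there are only countably many.\<close>
  define \<P> where "\<P> = range (\<lambda>(j, i, m). \<Omega> j \<inter> \<psi> j -` A i m)"
  define E where "E = Q \<union> \<Union>\<P>"
  have "countable \<P>" by (simp add: \<P>_def)
  have "fsigma E"
  proof -
    have "closed P" if "P \<in> \<P>" for P
      using that assms(6,7) A(1) by (auto simp: \<P>_def intro!: continuous_closed_preimage)
    then have "fsigma_in euclidean (\<Union>\<P>)"
      using \<open>countable \<P>\<close> by (intro fsigma_in_Union closed_imp_fsigma_in) auto
    moreover have "fsigma_in euclidean (\<Union>((\<lambda>x. {x}) ` Q))"
      using Q(1) by (intro fsigma_in_Union) (auto intro: closed_imp_fsigma_in)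
    ultimately show ?thesis
      unfolding fsigma_iff_fsigma_in E_def by (simp add: fsigma_in_Un)
  qed
  moreover have "\<not> x isolated_in E" for x
  proof
    assume "x isolated_in E"
    then obtain T where T: "open T" "T \<inter> E = {x}"
      by (auto simp: isolated_in_def)
    \<comment> \<open>A Euclidean space of positive dimension has no open singletons, so the open
      set \<open>T - {x}\<close> is nonempty and meets the dense set \<open>Q\<close>.\<close>
    then have "T - {x} \<noteq> {}"
      using not_open_singleton[of x] by (metis Diff_eq_empty_iff Int_iff insertI1 insert_Diff subset_singletonD empty_iff)
    then obtain d where "d \<in> Q" "d \<in> T - {x}"
      using Q(2)[of "T - {x}"] T(1) by (auto simp: open_delete)
    then show False
      using T(2) by (auto simp: E_def)
  qed
  moreover have "hausdorff_measure h E = 0"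
  proof -
    have "hausdorff_measure h P = 0" if "P \<in> insert Q \<P>" for P
      using that hausdorff_measure_countable_eq_0[OF h Q(1)]
        scaled_null_vimage_locally_Lipschitz_inverse[OF h A(2) assms(8,10)]
      by (auto simp: \<P>_def)
    then have "hausdorff_measure h (\<Union>(insert Q \<P>)) = 0"
      using \<open>countable \<P>\<close> by (intro hausdorff_measure_countable_Union_eq_0[OF h]) auto
    then show ?thesis by (simp add: E_def)
  qed
  moreover have "D \<inter> (\<Inter>f\<in>G. f -` E) \<noteq> {}" if "G \<subseteq> F" "countable G" for G
  \<comment> \<open>\<open>from_nat_into\<close> enumerates nonempty sets only; for empty
    \<open>G\<close> any point of \<open>D\<close> will do.\<close>
  proof (cases "G = {}")
    case True
    then show ?thesis using x0 by auto
  next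
    case False
    have "\<exists>j. f ` D \<subseteq> \<Omega> j \<and> bilipschitz_on (1 / real_of_int L) 1 D (\<psi> j \<circ> f)" if "f \<in> G" for f
      using that \<open>G \<subseteq> F\<close> by (intro assms(11)) blast
    then obtain j where j: "\<And>f. f \<in> G \<Longrightarrow> f ` D \<subseteq> \<Omega> (j f)"
      "\<And>f. f \<in> G \<Longrightarrow> bilipschitz_on (1 / real_of_int L) 1 D (\<psi> (j f) \<circ> f)"
      by metis
    \<comment> \<open>For finite \<open>G\<close> the enumeration repeats maps, which is harmless:
      each map needs just one index \<open>i\<close>.\<close>
    let ?f = "from_nat_into G"
    have "bilipschitz_on (1 / real_of_int L) 1 (cball x0 1) (\<psi> (j (?f i)) \<circ> ?f i)" for i
      using j(2)[OF from_nat_into[OF False]] x0 unfolding bilipschitz_on_def by blast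
    then obtain t where t: "t \<in> cball x0 1" "\<And>i. \<exists>m. (\<psi> (j (?f i)) \<circ> ?f i) t \<in> A i m"
      using univ[of x0 "\<lambda>i. \<psi> (j (?f i)) \<circ> ?f i"] by blast
    have "f t \<in> E" if f: "f \<in> G" for f
    proof -
      obtain i where i: "f = ?f i"
        using from_nat_into_surj[OF \<open>countable G\<close> f] by metis
      obtain m where "\<psi> (j f) (f t) \<in> A i m"
        using t(2)[of i] i by auto
      then have "f t \<in> \<Omega> (j f) \<inter> \<psi> (j f) -` A i m"
        using subsetD[OF j(1)[OF f] imageI[OF subsetD[OF x0 t(1)]]] by simp
      then show ?thesis
        unfolding E_def \<P>_def by force
    qed
    then have "t \<in> D \<inter> (\<Inter>f\<in>G. f -` E)"
      using subsetD[OF x0 t(1)] by auto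
    then show ?thesis by blast
  qed
  ultimately show ?thesis by blast
qed

end
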